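(* Let $\mathcal A\subseteq\mathbb N$, $L$ an environment and $T_1,T_2,U$ terms. If $L\vdash_{\mathcal A}T_1:U$ and $L\vdash T_1\to^{*0}T_2$, then $L\vdash_{\mathcal A}T_2:U$.
   Context: Fix a nonempty set $\Sigma$ of sorts with decidable equality, an arbitrary function $\mathrm{next}:\Sigma\to\Sigma$, and a countably infinite set of variables. Terms and environments: $T,U,V,W ::= \star s \mid x \mid \mathrm{app}(V,T) \mid \lambda x{:}W.\,T \mid \mathrm{def}(x{=}V).\,T \mid \mathrm{cast}(U,T)$ ($s\in\Sigma$) and $L,K ::= \emptyset \mid K,x{:}W \mid K,x{=}V$. $\mathrm{app}(V,T)$ applies $T$ to $V$; $\lambda x{:}W.\,T$ (de Bruijn's abstraction) and $\mathrm{def}(x{=}V).\,T$ (local definition) bind $x$ in $T$; $\mathrm{cast}(U,T)$ annotates $T$ with expected type $U$; entries $x{:}W$ and $x{=}V$ bind $x$. Terms are modulo renaming of bound variables. Write $\mathsf{B}x[V]$ for either $\lambda x{:}V$ or $\mathrm{def}(x{=}V)$ and correspondingly $L,x[V]$ for $L,x{:}V$ resp. $L,x{=}V$. One step of bound rt-reduction $L\vdash T_1\to^nT_2$ is the smallest relation closed under: $L\vdash\mathrm{app}(V,\lambda x{:}W.\,T)\to^0\mathrm{def}(x{=}\mathrm{cast}(W,V)).\,T$; $K,x{=}V\vdash x\to^0V$; $L\vdash\mathrm{def}(x{=}V).\,T\to^0T$ if $x$ not free in $T$; $L\vdash\mathrm{app}(V,\mathrm{def}(x{=}W).\,T)\to^0\mathrm{def}(x{=}W).\,\mathrm{app}(V,T)$;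 $L\vdash\mathrm{cast}(U,T)\to^0T$; $L\vdash\star s\to^1\star\,\mathrm{next}(s)$; $K,x{:}W\vdash x\to^1W$; $L\vdash\mathrm{cast}(U,T)\to^1U$; if $K\vdash x\to^nT$, $y\neq x$, $y$ not free in $T$ then $K,y[V]\vdash x\to^nT$; if $L\vdash V_1\to^0V_2$ then $L\vdash\mathrm{app}(V_1,T)\to^0\mathrm{app}(V_2,T)$; if $L\vdash T_1\to^nT_2$ then $L\vdash\mathrm{app}(V,T_1)\to^n\mathrm{app}(V,T_2)$; if $L\vdash V_1\to^0V_2$ then $L\vdash\mathsf Bx[V_1].\,T\to^0\mathsf Bx[V_2].\,T$; if $L,x[V]\vdash T_1\to^nT_2$ then $L\vdash\mathsf Bx[V].\,T_1\to^n\mathsf Bx[V].\,T_2$; if $L\vdash U_1\to^0U_2$ then $L\vdash\mathrm{cast}(U_1,T)\to^0\mathrm{cast}(U_2,T)$; if $L\vdash T_1\to^0T_2$ then $L\vdash\mathrm{cast}(U,T_1)\to^0\mathrm{cast}(U,T_2)$; if $L\vdash U_1\to^1U_2$ and $L\vdash T_1\to^1T_2$ then $L\vdash\mathrm{cast}(U_1,T_1)\to^1\mathrm{cast}(U_2,T_2)$. $L\vdash T_1\to^{*n}T_2$ is the smallest relation with $L\vdash T\to^{*0}T$, containing single steps, and with $L\vdash T_1\to^{*n_1}T$, $L\vdash T\to^{*n_2}T_2$ implying $L\vdash T_1\to^{*n_1+n_2}T_2$. Validity $L\vdash_{\mathcal A}T$ is the smallest predicate closed under: $L\vdash_{\mathcal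 A}\star s$; if $K\vdash_{\mathcal A}V$ then $K,x[V]\vdash_{\mathcal A}x$; if $K\vdash_{\mathcal A}x$ and $y\neq x$ then $K,y[V]\vdash_{\mathcal A}x$; if $L\vdash_{\mathcal A}V$ and $L,x[V]\vdash_{\mathcal A}T$ then $L\vdash_{\mathcal A}\mathsf Bx[V].\,T$; if $L\vdash_{\mathcal A}U$, $L\vdash_{\mathcal A}T$ and some $U_0$ satisfies $L\vdash T\to^{*1}U_0$, $L\vdash U\to^{*0}U_0$, then $L\vdash_{\mathcal A}\mathrm{cast}(U,T)$; if $L\vdash_{\mathcal A}V$, $L\vdash_{\mathcal A}T$ and there are $n\in\mathcal A$, $x,W_0,U_0$ with $L\vdash T\to^{*n}\lambda x{:}W_0.\,U_0$ and $L\vdash V\to^{*1}W_0$, then $L\vdash_{\mathcal A}\mathrm{app}(V,T)$. The type judgment $L\vdash_{\mathcal A}T:U$ means $L\vdash_{\mathcal A}\mathrm{cast}(U,T)$. *)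

theory Defs
  imports Main
begin

text \<open>
  Terms modulo renaming of bound variables are represented with de Bruijn indices:
  the body of a binder sees the bound variable as index 0. An environment is a list
  whose head is its rightmost (innermost) entry, so the index \<open>i\<close> refers to
  the entry at position \<open>i\<close>; indices beyond the length of the environment
  are variables that it does not bind.
  The sorts are the elements of the type \<open>'s\<close>.
\<close>

datatype kind = Abst | Abbr

datatype 's trm =
    Sort 's
  | Var nat
  | App "'s trm" "'s trm"  \<comment> \<open>the argument comes first: \<open>App V T\<close> applies \<open>T\<close> to \<open>V\<close>\<close>
  | Bind kind "'s trm" "'s trm"
  | Cast "'s trm" "'s trm"  \<comment> \<open>the expected type comes first\<close>

abbreviation Lam :: "'s trm \<Rightarrow> 's trm \<Rightarrow> 's trm" where
  "Lam W T \<equiv> Bind Abst W T"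

abbreviation Def :: "'s trm \<Rightarrow> 's trm \<Rightarrow> 's trm" where
  "Def V T \<equiv> Bind Abbr V T"

type_synonym 's env = "(kind \<times> 's trm) list"

text \<open>
  \<open>lift k T\<close> inserts a fresh variable at index \<open>k\<close>. Hence the terms in
  which the variable of index 0 does not occur free are those of the form
  \<open>lift 0 T\<close>, where \<open>T\<close> is the same term outside the scope of that variable.
\<close>

primrec lift :: "nat \<Rightarrow> 's trm \<Rightarrow> 's trm" where
  "lift k (Sort s) = Sort s"
| "lift k (Var i) = Var (if i < k then i else Suc i)"
| "lift k (App V T) = App (lift k V) (lift k T)"
| "lift k (Bind b V T) = Bind b (lift k V) (lift (Suc k) T)"
| "lift k (Cast U T) = Cast (lift k U) (lift k T)"

text \<open>\<open>step nxt L n T1 T2\<close> is \<open>L \<turnstile> T1 \<rightarrow>\<^sup>n T2\<close>, with \<open>nxt\<close> the successor function on sorts.\<close>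

inductive step :: "('s \<Rightarrow> 's) \<Rightarrow> 's env \<Rightarrow> nat \<Rightarrow> 's trm \<Rightarrow> 's trm \<Rightarrow> bool"
  for nxt :: "'s \<Rightarrow> 's" where
  beta: "step nxt L 0 (App V (Lam W T)) (Def (Cast W V) T)"
| delta: "step nxt ((Abbr, V) # K) 0 (Var 0) (lift 0 V)"
| zeta: "step nxt L 0 (Def V (lift 0 T)) T"
| theta: "step nxt L 0 (App V (Def W T)) (Def W (App (lift 0 V) T))"
| eps: "step nxt L 0 (Cast U T) T"
| sort: "step nxt L 1 (Sort s) (Sort (nxt s))"
| ell: "step nxt ((Abst, W) # K) 1 (Var 0) (lift 0 W)"
| ee: "step nxt L 1 (Cast U T) U"
| weak: "step nxt K n (Var i) T \<Longrightarrow> step nxt ((b, V) # K) n (Var (Suc i)) (lift 0 T)"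
| app_arg: "step nxt L 0 V1 V2 \<Longrightarrow> step nxt L 0 (App V1 T) (App V2 T)"
| app_fun: "step nxt L n T1 T2 \<Longrightarrow> step nxt L n (App V T1) (App V T2)"
| bind_arg: "step nxt L 0 V1 V2 \<Longrightarrow> step nxt L 0 (Bind b V1 T) (Bind b V2 T)"
| bind_body: "step nxt ((b, V) # L) n T1 T2 \<Longrightarrow> step nxt L n (Bind b V T1) (Bind b V T2)"
| cast_type: "step nxt L 0 U1 U2 \<Longrightarrow> step nxt L 0 (Cast U1 T) (Cast U2 T)"
| cast_term: "step nxt L 0 T1 T2 \<Longrightarrow> step nxt L 0 (Cast U T1) (Cast U T2)"
| cast_both: "step nxt L 1 U1 U2 \<Longrightarrow> step nxt L 1 T1 T2 \<Longrightarrow> step nxt L 1 (Cast U1 T1) (Cast U2 T2)"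

inductive steps :: "('s \<Rightarrow> 's) \<Rightarrow> 's env \<Rightarrow> nat \<Rightarrow> 's trm \<Rightarrow> 's trm \<Rightarrow> bool"
  for nxt :: "'s \<Rightarrow> 's" and L :: "'s env" where
  refl: "steps nxt L 0 T T"
| single: "step nxt L n T1 T2 \<Longrightarrow> steps nxt L n T1 T2"
| trans: "steps nxt L n1 T1 T \<Longrightarrow> steps nxt L n2 T T2 \<Longrightarrow> steps nxt L (n1 + n2) T1 T2"

inductive valid :: "('s \<Rightarrow> 's) \<Rightarrow> nat set \<Rightarrow> 's env \<Rightarrow> 's trm \<Rightarrow> bool"
  for nxt :: "'s \<Rightarrow> 's" and A :: "nat set" where
  sort: "valid nxt A L (Sort s)"
| var_0: "valid nxt A K V \<Longrightarrow> valid nxt A ((b, V) # K) (Var 0)"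
| var_Suc: "valid nxt A K (Var i) \<Longrightarrow> valid nxt A ((b, V) # K) (Var (Suc i))"
| bind: "valid nxt A L V \<Longrightarrow> valid nxt A ((b, V) # L) T \<Longrightarrow> valid nxt A L (Bind b V T)"
| cast: "valid nxt A L U \<Longrightarrow> valid nxt A L T \<Longrightarrow>
    steps nxt L 1 T U0 \<Longrightarrow> steps nxt L 0 U U0 \<Longrightarrow> valid nxt A L (Cast U T)"
| app: "valid nxt A L V \<Longrightarrow> valid nxt A L T \<Longrightarrow> n \<in> A \<Longrightarrow>
    steps nxt L n T (Lam W0 U0) \<Longrightarrow> steps nxt L 1 V W0 \<Longrightarrow> valid nxt A L (App V T)"

definition has_type :: "('s \<Rightarrow> 's) \<Rightarrow> nat set \<Rightarrow> 's env \<Rightarrow> 's trm \<Rightarrow> 's trm \<Rightarrow> bool" where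
  "has_type nxt A L T U \<longleftrightarrow> valid nxt A L (Cast U T)"

end

theory Submission
  imports Defs
begin

text \<open>
  Every term \<open>T\<close> has a canonical type \<open>ty L T\<close>, computed by recursion, and \<open>T\<close> reduces to it in one
  t-step if it is valid. Call a cast \<open>Cast U T\<close> good if \<open>U\<close> and \<open>ty L T\<close> are convertible, where
  conversion is generated by the r-steps that erase only good casts. Convertible terms have
  convertible canonical types, whether or not the terms are valid; hence goodness is stable under
  reduction, and the restricted r-reduction is confluent by the method of complete developments.
  Let validity up to conversion be validity with the reductions in its premises replaced by
  conversions with iterated canonical types. It makes all casts good, so that
  all r-steps are conversions and each t-step yields the canonical type up to conversion. Therefore
  it is preserved by single steps; in the case of a \<open>\<beta>\<close>-step confluence identifies the domains of
  convertible abstractions. By confluence it agrees with validity. No normalization argument is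
  needed.
\<close>

section \<open>Lifting, substitution and canonical types\<close>

primrec subst :: "nat \<Rightarrow> 's trm \<Rightarrow> 's trm \<Rightarrow> 's trm" where
  "subst k V (Sort s) = Sort s"
| "subst k V (Var i) = (if i < k then Var i else if i = k then V else Var (i - 1))"
| "subst k V (App U T) = App (subst k V U) (subst k V T)"
| "subst k V (Bind b U T) = Bind b (subst k V U) (subst (Suc k) (lift 0 V) T)"
| "subst k V (Cast U T) = Cast (subst k V U) (subst k V T)"

primrec occurs :: "nat \<Rightarrow> 's trm \<Rightarrow> bool" where
  "occurs k (Sort s) \<longleftrightarrow> False"
| "occurs k (Var i) \<longleftrightarrow> i = k"
| "occurs k (App V T) \<longleftrightarrow> occurs k V \<or> occurs k T"
| "occurs k (Bind b V T) \<longleftrightarrow> occurs k V \<or> occurs (Suc k) T"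
| "occurs k (Cast U T) \<longleftrightarrow> occurs k U \<or> occurs k T"

lemma lift_lift: "j \<le> k \<Longrightarrow> lift j (lift k T) = lift (Suc k) (lift j T)"
  by (induction T arbitrary: j k) auto

lemma lift_lift_0: "lift 0 (lift k T) = lift (Suc k) (lift 0 T)"
  by (simp add: lift_lift)

lemma subst_lift [simp]: "subst k V (lift k T) = T"
  by (induction T arbitrary: k V) auto

lemma subst_lift_le: "j \<le> k \<Longrightarrow> subst (Suc k) (lift j V) (lift j T) = lift j (subst k V T)"
  by (induction T arbitrary: j k V) (auto simp: lift_lift_0)

lemma subst_Suc_lift: "subst (Suc k) (lift 0 V) (lift 0 T) = lift 0 (subst k V T)"
  by (simp add: subst_lift_le)

lemma occurs_lift: "occurs j (lift k T) \<longleftrightarrow> (if j < k then occurs j T else k < j \<and> occurs (j - 1) T)"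
  by (induction T arbitrary: j k) (auto split: if_splits simp: Suc_diff_Suc)

text \<open>Turns non-occurrence into the shape \<open>lift k _\<close> by which the calculus
  expresses it. The term \<open>V\<close> is arbitrary: it is never inserted, and the substitution
  only lowers the indices above \<open>k\<close>.\<close>

lemma lift_subst_not_occurs: "\<not> occurs k T \<Longrightarrow> lift k (subst k V T) = T"
  by (induction T arbitrary: k V) auto

context
  fixes nxt :: "'s \<Rightarrow> 's"
begin

text \<open>
  The first argument of \<open>ctyp\<close> gives the types of the variables. A definition has the type of its
  definiens, and the choice of \<open>U\<close> as the type of \<open>Cast U T\<close> makes an entry
  \<open>x = Cast W V\<close> indistinguishable from \<open>x : W\<close> for the purpose of computing types.
\<close>

primrec ctyp :: "(nat \<Rightarrow> 's trm) \<Rightarrow> 's trm \<Rightarrow> 's trm" where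
  "ctyp e (Sort s) = Sort (nxt s)"
| "ctyp e (Var i) = e i"
| "ctyp e (App V T) = App V (ctyp e T)"
| "ctyp e (Bind b V T) =
    Bind b V (ctyp (case_nat (lift 0 (if b = Abst then V else ctyp e V)) (\<lambda>i. lift 0 (e i))) T)"
| "ctyp e (Cast U T) = U"

text \<open>The value on \<open>[]\<close> is a default that keeps \<open>ty\<close> total: an index
  that the environment does not bind is its own type.\<close>

primrec var_types :: "'s env \<Rightarrow> nat \<Rightarrow> 's trm" where
  "var_types [] = Var"
| "var_types (E # L) =
    case_nat (lift 0 (if fst E = Abst then snd E else ctyp (var_types L) (snd E)))
      (\<lambda>i. lift 0 (var_types L i))"

definition ty :: "'s env \<Rightarrow> 's trm \<Rightarrow> 's trm" where
  "ty L = ctyp (var_types L)"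

lemma ty_simps [simp]:
  "ty L (Sort s) = Sort (nxt s)"
  "ty L (App V T) = App V (ty L T)"
  "ty L (Bind b V T) = Bind b V (ty ((b, V) # L) T)"
  "ty L (Cast U T) = U"
  "ty ((Abst, V) # L) (Var 0) = lift 0 V"
  "ty ((Abbr, V) # L) (Var 0) = lift 0 (ty L V)"
  "ty ((b, V) # L) (Var (Suc i)) = lift 0 (ty L (Var i))"
  by (simp_all add: ty_def)

text \<open>The type of a cast is its annotation, so both entries give index 0 the type
  \<open>W\<close>. Hence a \<beta>-step does not change how the body is typed.\<close>

lemma ty_refine: "ty ((Abbr, Cast W V) # L) = ty ((Abst, W) # L)"
  by (simp add: ty_def)

lemma funpow_ty_App: "(ty L ^^ n) (App V T) = App V ((ty L ^^ n) T)"
  by (induction n) auto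

lemma funpow_ty_Bind: "(ty L ^^ n) (Bind b V T) = Bind b V ((ty ((b, V) # L) ^^ n) T)"
  by (induction n) auto

section \<open>Canonical types commute with lifting and with unfolding of definitions\<close>

inductive insert_env :: "nat \<Rightarrow> 's env \<Rightarrow> 's env \<Rightarrow> bool" where
  insert_0: "insert_env 0 L (E # L)"
| insert_Suc: "insert_env k L L' \<Longrightarrow> insert_env (Suc k) ((b, V) # L) ((b, lift k V) # L')"

text \<open>Only defined variables are replaced, and only by their own definiens. The term
  \<open>V\<close> is written relative to the resulting environment \<open>L'\<close>.\<close>

inductive subst_env :: "nat \<Rightarrow> 's trm \<Rightarrow> 's env \<Rightarrow> 's env \<Rightarrow> bool" where
  subst_0: "subst_env 0 V ((Abbr, V) # L) L"
| subst_Suc: "subst_env k V L L' \<Longrightarrow>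
    subst_env (Suc k) (lift 0 V) ((b, W) # L) ((b, subst k V W) # L')"

text \<open>Arbitrary type assignments are allowed because \<open>var_types_insert\<close> applies
  this to the entries of an environment, and \<open>ctyp_subst\<close> applies it with an
  unconstrained type for index 0.\<close>

lemma ctyp_lift:
  assumes "\<And>i. e' (if i < k then i else Suc i) = lift k (e i)"
  shows "ctyp e' (lift k T) = lift k (ctyp e T)"
  using assms
proof (induction T arbitrary: k e e')
  case (Bind b V T)
  have V: "ctyp e' (lift k V) = lift k (ctyp e V)"
    using Bind by blast
  let ?f = "\<lambda>V e. case_nat (lift 0 (if b = Abst then V else ctyp e V)) (\<lambda>i. lift 0 (e i))"
  have "ctyp (?f (lift k V) e') (lift (Suc k) T) = lift (Suc k) (ctyp (?f V e) T)"
  proof (rule Bind.IH(2))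
    fix i
    show "?f (lift k V) e' (if i < Suc k then i else Suc i) = lift (Suc k) (?f V e i)"
      \<comment> \<open>A positive index \<open>i\<close> under the binder is the index
        \<open>i - 1\<close> outside.\<close>
      using Bind.prems[of "i - 1"] by (cases i) (auto simp: V lift_lift_0 split: if_splits)
  qed
  then show ?case
    using V by simp
qed auto

lemma var_types_insert:
  "insert_env k L L' \<Longrightarrow> var_types L' (if i < k then i else Suc i) = lift k (var_types L i)"
proof (induction k L L' arbitrary: i rule: insert_env.induct)
  case (insert_Suc k L L' b V)
  have "ctyp (var_types L') (lift k V) = lift k (ctyp (var_types L) V)"
    by (rule ctyp_lift) (rule insert_Suc.IH)
  then show ?case
    using insert_Suc.IH[of "i - 1"] by (cases i) (auto simp: lift_lift_0 split: if_splits)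
qed simp

lemma ty_lift: "insert_env k L L' \<Longrightarrow> ty L' (lift k T) = lift k (ty L T)"
  unfolding ty_def by (rule ctyp_lift) (rule var_types_insert)

lemma ty_lift_0: "ty (E # L) (lift 0 T) = lift 0 (ty L T)"
  by (rule ty_lift) (rule insert_0)

lemma funpow_ty_lift: "insert_env k L L' \<Longrightarrow> (ty L' ^^ n) (lift k T) = lift k ((ty L ^^ n) T)"
  by (induction n) (auto simp: ty_lift)

text \<open>The middle case of the hypothesis says that the replaced variable has the canonical type
  of \<open>V\<close>. An entry that defines it as \<open>V\<close> ensures this.\<close>

lemma ctyp_subst:
  assumes "\<And>i. subst k V (e i) = (if i < k then e' i else if i = k then ctyp e' V else e' (i - 1))"
  shows "ctyp e' (subst k V T) = subst k V (ctyp e T)"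
  using assms
proof (induction T arbitrary: k V e e')
  case (Bind b U T)
  have U: "ctyp e' (subst k V U) = subst k V (ctyp e U)"
    using Bind by blast
  have V: "ctyp (case_nat X (\<lambda>i. lift 0 (e' i))) (lift 0 V) = lift 0 (ctyp e' V)" for X
    by (rule ctyp_lift) simp
  let ?f = "\<lambda>U e. case_nat (lift 0 (if b = Abst then U else ctyp e U)) (\<lambda>i. lift 0 (e i))"
  have "ctyp (?f (subst k V U) e') (subst (Suc k) (lift 0 V) T) = subst (Suc k) (lift 0 V) (ctyp (?f U e) T)"
  proof (rule Bind.IH(2))
    fix i
    show "subst (Suc k) (lift 0 V) (?f U e i) = (if i < Suc k then ?f (subst k V U) e' i
        else if i = Suc k then ctyp (?f (subst k V U) e') (lift 0 V) else ?f (subst k V U) e' (i - 1))"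
      using Bind.prems[of "i - 1"]
      by (cases i) (auto simp: U V subst_Suc_lift gr0_conv_Suc split: nat.split)
  qed
  then show ?case
    using U by simp
qed auto

lemma var_types_subst:
  "subst_env k V L L' \<Longrightarrow> subst k V (var_types L i) =
    (if i < k then var_types L' i else if i = k then ctyp (var_types L') V else var_types L' (i - 1))"
proof (induction k V L L' arbitrary: i rule: subst_env.induct)
  case (subst_0 V L)
  then show ?case by (cases i) auto
next
  case (subst_Suc k V L L' b W)
  have V: "ctyp (case_nat X (\<lambda>i. lift 0 (var_types L' i))) (lift 0 V) = lift 0 (ctyp (var_types L') V)" for X
    by (rule ctyp_lift) simp
  have "ctyp (var_types L') (subst k V W) = subst k V (ctyp (var_types L) W)"
    by (rule ctyp_subst) (rule subst_Suc.IH)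
  then show ?case
    using subst_Suc.IH[of "i - 1"]
    by (cases i) (auto simp: V subst_Suc_lift split: nat.split)
qed

lemma ty_subst: "subst_env k V L L' \<Longrightarrow> ty L' (subst k V T) = subst k V (ty L T)"
  unfolding ty_def by (rule ctyp_subst) (rule var_types_subst)

lemma funpow_ty_subst:
  "subst_env k V L L' \<Longrightarrow> (ty L' ^^ n) (subst k V T) = subst k V ((ty L ^^ n) T)"
  by (induction n) (auto simp: ty_subst)

section \<open>Parallel reduction and conversion\<close>

text \<open>
  The two relations are defined together because a cast may be erased only if it is well typed up
  to the conversion that these steps generate. No other step can change the canonical type by more
  than a conversion, so this condition yields \<open>par_ty\<close>.
\<close>

inductive par :: "'s env \<Rightarrow> 's trm \<Rightarrow> 's trm \<Rightarrow> bool"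
  and conv :: "'s env \<Rightarrow> 's trm \<Rightarrow> 's trm \<Rightarrow> bool" where
  par_Sort: "par L (Sort s) (Sort s)"
| par_Var: "par L (Var i) (Var i)"
| par_delta: "par K V V' \<Longrightarrow> par ((Abbr, V) # K) (Var 0) (lift 0 V')"
| par_weak: "par K (Var i) T \<Longrightarrow> par (E # K) (Var (Suc i)) (lift 0 T)"
| par_App: "par L V V' \<Longrightarrow> par L T T' \<Longrightarrow> par L (App V T) (App V' T')"
| par_Bind: "par L V V' \<Longrightarrow> par ((b, V) # L) T T' \<Longrightarrow> par L (Bind b V T) (Bind b V' T')"
| par_Cast: "par L U U' \<Longrightarrow> par L T T' \<Longrightarrow> par L (Cast U T) (Cast U' T')"
| par_zeta: "par ((Abbr, V) # L) T (lift 0 T') \<Longrightarrow> par L (Def V T) T'"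
| par_eps: "conv L U (ty L T) \<Longrightarrow> par L T T' \<Longrightarrow> par L (Cast U T) T'"
| par_beta: "par L V V' \<Longrightarrow> par L W W' \<Longrightarrow> par ((Abst, W) # L) T T' \<Longrightarrow>
    par L (App V (Lam W T)) (Def (Cast W' V') T')"
| par_theta: "par L V V' \<Longrightarrow> par L W W' \<Longrightarrow> par ((Abbr, W) # L) T T' \<Longrightarrow>
    par L (App V (Def W T)) (Def W' (App (lift 0 V') T'))"
| conv_par: "par L T T' \<Longrightarrow> conv L T T'"
| conv_sym: "conv L T T' \<Longrightarrow> conv L T' T"
| conv_trans [trans]: "conv L T T' \<Longrightarrow> conv L T' T'' \<Longrightarrow> conv L T T''"

inductive_cases par_SortE: "par L (Sort s) T"
inductive_cases par_Var_NilE: "par [] (Var i) T"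
inductive_cases par_Var_0E: "par (E # L) (Var 0) T"
inductive_cases par_Var_SucE: "par (E # L) (Var (Suc i)) T"
inductive_cases par_AppE: "par L (App V T) X"
inductive_cases par_LamE: "par L (Lam V T) X"

lemma par_refl [simp, intro]: "par L T T"
  by (induction T arbitrary: L) (auto intro: par_conv.intros)

lemma conv_refl [simp, intro]: "conv L T T"
  by (simp add: conv_par)

text \<open>One argument is converted at a time: reflexivity of \<open>par\<close> fills the other
  one in each generating step. Taking the predicate for \<open>par\<close> to be \<open>True\<close>
  turns the mutual induction into a plain induction on conversions.\<close>

lemma conv_App:
  assumes "conv L V V'" "conv L T T'"
  shows "conv L (App V T) (App V' T')"
proof -
  have "conv L V V' \<Longrightarrow> conv L (App V T) (App V' T)"
    by (induction L V V' rule: par_conv.inducts(2)[where ?P1.0 = "\<lambda>_ _ _. True"])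
       (auto intro: conv_par conv_sym conv_trans par_App)
  moreover have "conv L T T' \<Longrightarrow> conv L (App V' T) (App V' T')"
    by (induction L T T' rule: par_conv.inducts(2)[where ?P1.0 = "\<lambda>_ _ _. True"])
       (auto intro: conv_par conv_sym conv_trans par_App)
  ultimately show ?thesis
    using assms conv_trans by blast
qed

lemma conv_Cast_type: "conv L U U' \<Longrightarrow> conv L (Cast U T) (Cast U' T)"
  by (induction L U U' rule: par_conv.inducts(2)[where ?P1.0 = "\<lambda>_ _ _. True"])
     (auto intro: conv_par conv_sym conv_trans par_Cast)

lemma conv_Cast_term: "conv L T T' \<Longrightarrow> conv L (Cast U T) (Cast U T')"
  by (induction L T T' rule: par_conv.inducts(2)[where ?P1.0 = "\<lambda>_ _ _. True"])
     (auto intro: conv_par conv_sym conv_trans par_Cast)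

lemma conv_Bind_body: "conv ((b, V) # L) T T' \<Longrightarrow> conv L (Bind b V T) (Bind b V T')"
proof (induction "(b, V) # L" T T' rule: par_conv.inducts(2)[where ?P1.0 = "\<lambda>_ _ _. True"])
  case (conv_par T T')
  then show ?case by (auto intro: par_conv.conv_par par_Bind)
qed (auto intro: conv_sym conv_trans)

lemma conv_Bind_arg: "conv L V V' \<Longrightarrow> conv L (Bind b V T) (Bind b V' T)"
  by (induction L V V' rule: par_conv.inducts(2)[where ?P1.0 = "\<lambda>_ _ _. True"])
     (auto intro: conv_par conv_sym conv_trans par_Bind)

lemma par_lift: "par L T T' \<Longrightarrow> insert_env k L L' \<Longrightarrow> par L' (lift k T) (lift k T')"
  and conv_lift: "conv L T T' \<Longrightarrow> insert_env k L L' \<Longrightarrow> conv L' (lift k T) (lift k T')"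
proof (induction arbitrary: k L' and k L' rule: par_conv.inducts)
  case (par_delta K V V')
  from par_delta.prems show ?case
  proof cases
    case insert_0
    with par_conv.par_weak[OF par_conv.par_delta[OF par_delta.IH(1)]] show ?thesis by simp
  next
    case (insert_Suc k K')
    with par_conv.par_delta[OF par_delta.IH(2)] show ?thesis by (simp add: lift_lift_0 [symmetric])
  qed
next
  case (par_weak K i T E)
  from par_weak.prems show ?case
  proof cases
    case insert_0
    with par_conv.par_weak[OF par_conv.par_weak[OF par_weak.IH(1)]] show ?thesis by simp
  next
    case (insert_Suc k K' b W)
    with par_weak.IH(2) have "par K' (Var (if i < k then i else Suc i)) (lift k T)"
      by simp
    from par_conv.par_weak[OF this] insert_Suc show ?thesis
      by (cases "i < k") (simp_all add: lift_lift_0 [symmetric])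
  qed
next
  case (par_Bind L V V' b T T')
  then show ?case by (auto intro!: par_conv.par_Bind par_Bind.IH insert_Suc)
next
  case (par_zeta V L T T')
  then show ?case
    using par_zeta.IH(2)[OF insert_Suc] by (auto intro!: par_conv.par_zeta simp: lift_lift_0)
next
  case (par_eps L U T T')
  then show ?case by (auto intro!: par_conv.par_eps simp: ty_lift)
next
  case (par_beta L V V' W W' T T')
  then show ?case by (auto intro!: par_conv.par_beta par_beta.IH insert_Suc)
next
  case (par_theta L V V' W W' T T')
  then show ?case
    by (auto intro!: par_conv.par_theta par_theta.IH insert_Suc simp: lift_lift_0 [symmetric])
next
  case (conv_trans L T T' T'')
  then show ?case using par_conv.conv_trans by blast
qed (auto intro: par_conv.intros)

lemmas par_lift_0 = par_lift [OF _ insert_0]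
lemmas conv_lift_0 = conv_lift [OF _ insert_0]

text \<open>A \<delta>-step at the replaced variable becomes the reduction of its definiens, which
  the induction hypothesis provides.\<close>

lemma par_subst: "par L T T' \<Longrightarrow> subst_env k V L L' \<Longrightarrow> par L' (subst k V T) (subst k V T')"
  and conv_subst: "conv L T T' \<Longrightarrow> subst_env k V L L' \<Longrightarrow> conv L' (subst k V T) (subst k V T')"
proof (induction arbitrary: k V L' and k V L' rule: par_conv.inducts)
  case (par_delta K W W')
  from par_delta.prems show ?case
  proof cases
    case subst_0
    with par_delta.IH(1) show ?thesis by simp
  next
    case (subst_Suc k V K')
    with par_conv.par_delta[OF par_delta.IH(2)] show ?thesis by (simp add: subst_Suc_lift)
  qed
next
  case (par_weak K i T E)
  from par_weak.prems show ?case
  proof cases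
    case subst_0
    with par_weak.IH(1) show ?thesis by simp
  next
    case (subst_Suc k V K' b U)
    then have "par ((b, subst k V U) # K') (lift 0 (subst k V (Var i))) (lift 0 (subst k V T))"
      using par_lift_0[OF par_weak.IH(2)] by simp
    with subst_Suc show ?thesis
      by (simp only: subst_Suc_lift [symmetric]) simp
  qed
next
  case (par_Bind L V V' b T T')
  then show ?case by (auto intro!: par_conv.par_Bind par_Bind.IH subst_Suc)
next
  case (par_zeta W L T T')
  then show ?case
    using par_zeta.IH(2)[OF subst_Suc] by (auto intro!: par_conv.par_zeta simp: subst_Suc_lift)
next
  case (par_eps L U T T')
  then show ?case by (auto intro!: par_conv.par_eps simp: ty_subst)
next
  case (par_beta L V V' W W' T T')
  then show ?case by (auto intro!: par_conv.par_beta par_beta.IH subst_Suc)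
next
  case (par_theta L V V' W W' T T')
  then show ?case
    by (auto intro!: par_conv.par_theta par_theta.IH subst_Suc simp: subst_Suc_lift)
next
  case (conv_trans L T T' T'')
  then show ?case using par_conv.conv_trans by blast
qed (auto intro: par_conv.intros)

text \<open>One parallel step can unfold all occurrences of a defined variable at once. The outer
  \<open>lift k\<close> records that the variable is then gone.\<close>

lemma par_subst_lift: "subst_env k V L L' \<Longrightarrow> par L T (lift k (subst k V T))"
proof (induction T arbitrary: k V L L')
  case (Var i)
  from Var show ?case
  proof (induction k V L L' arbitrary: i rule: subst_env.induct)
    case (subst_0 V L)
    then show ?case by (cases i) (auto intro: par_delta)
  next
    case (subst_Suc k V L L' b W)
    show ?case
    proof (cases i)
      case (Suc j)
      from par_weak[OF subst_Suc.IH[of j]] show ?thesis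
        unfolding Suc lift_lift_0 subst_Suc_lift [symmetric] by simp
    qed auto
  qed
next
  case (Bind b U T)
  then show ?case by (auto intro!: par_Bind Bind.IH(2) subst_Suc)
qed (auto intro: par_conv.intros)

text \<open>The types of corresponding entries are required to be convertible separately, since
  \<open>conv_ty\<close> is itself proved by means of this relation. The rule
  \<open>env_conv_refine\<close> is the change of environment caused by a \<beta>-step.\<close>

inductive env_conv :: "'s env \<Rightarrow> 's env \<Rightarrow> bool" where
  env_conv_Nil: "env_conv [] []"
| env_conv_Cons: "env_conv L L' \<Longrightarrow> conv L' V V' \<Longrightarrow> conv L' (ty L V) (ty L' V') \<Longrightarrow>
    env_conv ((b, V) # L) ((b, V') # L')"
| env_conv_refine: "env_conv L L' \<Longrightarrow> env_conv ((Abst, W) # L) ((Abbr, Cast W V) # L')"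

lemma conv_ty_env: "env_conv L L' \<Longrightarrow> conv L' (ty L T) (ty L' T)"
proof (induction T arbitrary: L L')
  case (Var i)
  from Var show ?case
  proof (induction L L' arbitrary: i rule: env_conv.induct)
    case (env_conv_Cons L L' V V' b)
    then show ?case
      by (cases i; cases b) (auto intro: conv_lift_0)
  next
    case (env_conv_refine L L' W V)
    then show ?case
      by (cases i) (auto intro: conv_lift_0)
  qed simp
next
  case (Bind b V T)
  then show ?case by (auto intro!: conv_Bind_body env_conv_Cons Bind.IH)
qed (auto intro: conv_App)

lemma env_conv_Cons_same: "env_conv L L' \<Longrightarrow> env_conv (E # L) (E # L')"
  by (cases E) (auto intro: env_conv_Cons conv_ty_env)

text \<open>A parallel step becomes only a conversion, because a variable may now unfold to a
  different, convertible definiens. Good casts stay good by \<open>conv_ty_env\<close>.\<close>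

lemma conv_par_env: "par L T T' \<Longrightarrow> env_conv L L' \<Longrightarrow> conv L' T T'"
  and conv_env: "conv L T T' \<Longrightarrow> env_conv L L' \<Longrightarrow> conv L' T T'"
proof (induction arbitrary: L' and L' rule: par_conv.inducts)
  case (par_delta K V V')
  from par_delta.prems show ?case
  proof cases
    case (env_conv_Cons K' V2)
    then have "conv K' V2 V'"
      using par_delta.IH(2) conv_sym conv_trans by blast
    with env_conv_Cons show ?thesis
      by (auto intro: conv_trans[OF conv_par[OF par_conv.par_delta[OF par_refl]]] conv_lift_0)
  qed
next
  case (par_weak K i T E)
  from par_weak.prems show ?case
    by cases
       (use conv_lift_0[OF par_weak.IH(2)] in auto)
next
  case (par_App L V V' T T')
  then show ?case by (auto intro: conv_App)
next
  case (par_Bind L V V' b T T')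
  then have "conv L' (Bind b V T) (Bind b V T')"
    by (intro conv_Bind_body par_Bind.IH(4) env_conv_Cons_same)
  also have "conv L' \<dots> (Bind b V' T')"
    using par_Bind by (auto intro: conv_Bind_arg)
  finally show ?case .
next
  case (par_Cast L U U' T T')
  then show ?case by (meson conv_Cast_type conv_Cast_term conv_trans)
next
  case (par_zeta V L T T')
  then have "conv L' (Def V T) (Def V (lift 0 T'))"
    by (intro conv_Bind_body par_zeta.IH(2) env_conv_Cons_same)
  also have "conv L' \<dots> T'"
    by (auto intro: conv_par par_conv.par_zeta)
  finally show ?case .
next
  case (par_eps L U T T')
  then have "conv L' U (ty L' T)"
    using conv_ty_env conv_trans by blast
  then have "conv L' (Cast U T) T"
    by (auto intro: conv_par par_conv.par_eps)
  with par_eps show ?case using conv_trans by blast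
next
  case (par_beta L V V' W W' T T')
  then have "conv L' (Lam W T) (Lam W T')"
    by (intro conv_Bind_body par_beta.IH(6) env_conv_Cons_same)
  also have "conv L' \<dots> (Lam W' T')"
    using par_beta by (auto intro: conv_Bind_arg)
  finally have "conv L' (App V (Lam W T)) (App V' (Lam W' T'))"
    using par_beta by (auto intro: conv_App)
  also have "conv L' \<dots> (Def (Cast W' V') T')"
    by (auto intro: conv_par par_conv.par_beta)
  finally show ?case .
next
  case (par_theta L V V' W W' T T')
  then have "conv L' (Def W T) (Def W T')"
    by (intro conv_Bind_body par_theta.IH(6) env_conv_Cons_same)
  also have "conv L' \<dots> (Def W' T')"
    using par_theta by (auto intro: conv_Bind_arg)
  finally have "conv L' (App V (Def W T)) (App V' (Def W' T'))"
    using par_theta by (auto intro: conv_App)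
  also have "conv L' \<dots> (Def W' (App (lift 0 V') T'))"
    by (auto intro: conv_par par_conv.par_theta)
  finally show ?case .
qed (auto intro: conv_sym conv_trans)

lemma env_conv_refl: "env_conv L L"
  by (induction L) (auto intro: env_conv_Nil env_conv_Cons_same)

lemma env_conv_append: "env_conv L L' \<Longrightarrow> env_conv (M @ L) (M @ L')"
  by (induction M) (auto intro: env_conv_Cons_same)

text \<open>Reducing \<open>V\<close> also changes the environment in which the body is typed;
  \<open>conv_ty_env\<close> absorbs this. The conversion of the types of \<open>V\<close> and
  \<open>V'\<close> is assumed because in \<open>par_ty\<close> it is an induction
  hypothesis.\<close>

lemma conv_ty_Bind:
  assumes "par L V V'" "conv L (ty L V) (ty L V')"
    and "conv ((b, V) # L) (ty ((b, V) # L) T) (ty ((b, V) # L) T')"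
  shows "conv L (Bind b V (ty ((b, V) # L) T)) (Bind b V' (ty ((b, V') # L) T'))"
proof -
  have env: "env_conv ((b, V) # L) ((b, V') # L)"
    using assms(1,2) by (auto intro: env_conv_Cons env_conv_refl conv_par)
  have "conv L (Bind b V (ty ((b, V) # L) T)) (Bind b V (ty ((b, V) # L) T'))"
    by (rule conv_Bind_body) (rule assms(3))
  also have "conv L \<dots> (Bind b V' (ty ((b, V) # L) T'))"
    using assms(1) by (auto intro: conv_Bind_arg conv_par)
  also have "conv L \<dots> (Bind b V' (ty ((b, V') # L) T'))"
    by (rule conv_Bind_body) (rule conv_ty_env[OF env])
  finally show ?thesis .
qed

text \<open>The only step that could change the type is the erasure of a cast, and there the side
  condition of \<open>par_eps\<close> is exactly the required conversion. In the \<beta>-case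
  \<open>ty_refine\<close> identifies the types of the body.\<close>

lemma par_ty: "par L T T' \<Longrightarrow> conv L (ty L T) (ty L T')"
proof (induction L T T' rule: par_conv.inducts(1)[where ?P2.0 = "\<lambda>_ _ _. True"])
  case (par_App L V V' T T')
  then show ?case by (auto intro: conv_App conv_par)
next
  case (par_Bind L V V' b T T')
  then show ?case by (auto intro: conv_ty_Bind)
next
  case (par_zeta V L T T')
  then have "conv L (Def V (ty ((Abbr, V) # L) T)) (Def V (lift 0 (ty L T')))"
    by (auto intro: conv_Bind_body simp: ty_lift_0)
  also have "conv L \<dots> (ty L T')"
    by (auto intro: conv_par par_conv.par_zeta)
  finally show ?case by simp
next
  case (par_eps L U T T')
  then show ?case by (auto intro: conv_trans)
next
  case (par_beta L V V' W W' T T')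
  then have "conv L (App V (Lam W (ty ((Abst, W) # L) T))) (App V' (Lam W' (ty ((Abst, W') # L) T')))"
    by (intro conv_App conv_ty_Bind) (auto intro: conv_par)
  also have "conv L \<dots> (Def (Cast W' V') (ty ((Abst, W') # L) T'))"
    by (auto intro: conv_par par_conv.par_beta)
  finally show ?case by (simp add: ty_refine)
next
  case (par_theta L V V' W W' T T')
  then have "conv L (App V (Def W (ty ((Abbr, W) # L) T))) (App V' (Def W' (ty ((Abbr, W') # L) T')))"
    by (intro conv_App conv_ty_Bind) (auto intro: conv_par)
  also have "conv L \<dots> (Def W' (App (lift 0 V') (ty ((Abbr, W') # L) T')))"
    by (auto intro: conv_par par_conv.par_theta)
  finally show ?case by simp
qed (auto intro: conv_lift_0 conv_par simp: ty_lift_0)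

lemma conv_ty: "conv L T T' \<Longrightarrow> conv L (ty L T) (ty L T')"
  by (induction L T T' rule: par_conv.inducts(2)[where ?P1.0 = "\<lambda>_ _ _. True"])
     (auto intro: par_ty conv_sym conv_trans)

lemma conv_funpow_ty: "conv L T T' \<Longrightarrow> conv L ((ty L ^^ n) T) ((ty L ^^ n) T')"
  by (induction n) (auto intro: conv_ty)

lemma conv_funpow_ty_env: "env_conv L L' \<Longrightarrow> conv L' ((ty L ^^ n) T) ((ty L' ^^ n) T)"
  by (induction n) (auto intro: conv_ty conv_trans[OF conv_ty_env])

section \<open>Confluence\<close>

text \<open>An abstraction entry is never unfolded, so the same parallel step, and not just a
  conversion, is possible after the refinement. Only the conditions on erased casts have to be
  transported.\<close>

lemma par_refine: "par L T T' \<Longrightarrow> L = M @ (Abst, W) # K \<Longrightarrow> par (M @ (Abbr, Cast W V) # K) T T'"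
proof (induction arbitrary: M rule: par_conv.inducts(1)[where ?P2.0 = "\<lambda>_ _ _. True"])
  case (par_delta K V V')
  then show ?case by (cases M) (auto intro: par_conv.par_delta)
next
  case (par_weak K i T E)
  then show ?case by (cases M) (auto intro: par_conv.par_weak)
next
  case (par_Bind L V' V'' b T T')
  then show ?case using par_Bind.IH(2)[of "(b, V') # M"] by (auto intro: par_conv.par_Bind)
next
  case (par_zeta V' L T T')
  then show ?case using par_zeta.IH[of "(Abbr, V') # M"] by (auto intro: par_conv.par_zeta)
next
  case (par_beta L V' V'' W' W'' T T')
  then show ?case using par_beta.IH(3)[of "(Abst, W') # M"] by (auto intro: par_conv.par_beta)
next
  case (par_theta L V' V'' W' W'' T T')
  then show ?case using par_theta.IH(3)[of "(Abbr, W') # M"] by (auto intro: par_conv.par_theta)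
next
  case (par_eps L U T T')
  have "env_conv L (M @ (Abbr, Cast W V) # K)"
    unfolding par_eps.prems by (rule env_conv_append) (rule env_conv_refine[OF env_conv_refl])
  then have "conv (M @ (Abbr, Cast W V) # K) U (ty (M @ (Abbr, Cast W V) # K) T)"
    using par_eps.hyps(1) conv_env conv_ty_env conv_trans by blast
  with par_eps show ?case by (auto intro: par_conv.par_eps)
qed (auto intro: par_conv.intros)

section \<open>Complete developments and the triangle property\<close>

inductive par_env :: "'s env \<Rightarrow> 's env \<Rightarrow> bool" where
  par_env_Nil: "par_env [] []"
| par_env_Cons: "par_env L L' \<Longrightarrow> par L V V' \<Longrightarrow> par_env ((b, V) # L) ((b, V') # L')"

lemma par_env_refl: "par_env L L"
  by (induction L) (auto intro: par_env.intros)

lemma par_env_conv: "par_env L L' \<Longrightarrow> env_conv L L'"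
proof (induction rule: par_env.induct)
  case (par_env_Cons L L' V V' b)
  have "conv L' (ty L V) (ty L V')"
    using par_env_Cons par_ty conv_env by blast
  also have "conv L' \<dots> (ty L' V')"
    using par_env_Cons conv_ty_env by blast
  finally show ?case
    using par_env_Cons by (auto intro: env_conv_Cons conv_par_env)
qed (rule env_conv_Nil)

text \<open>An erasable cast remains erasable after reduction of its parts and its environment,
  which closes the triangle for \<open>dev_eps\<close>.\<close>

lemma conv_Cast_par:
  assumes "conv L U (ty L T)" "par L U U'" "par L T T'" "par_env L L'"
  shows "conv L' U' (ty L' T')"
proof -
  have "conv L U' (ty L T')"
    using assms(1-3) by (meson conv_par conv_sym conv_trans par_ty)
  with assms(4) show ?thesis
    using par_env_conv conv_env conv_ty_env conv_trans by blast
qed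

text \<open>
  The complete development unfolds definitions everywhere, so that their bodies lose the
  bound variable (\<open>dev_not_occurs\<close>) and the binder can always be removed.
\<close>

inductive dev :: "'s env \<Rightarrow> 's trm \<Rightarrow> 's trm \<Rightarrow> bool" where
  dev_Sort: "dev L (Sort s) (Sort s)"
| dev_Nil: "dev [] (Var i) (Var i)"
| dev_Abst: "dev ((Abst, W) # K) (Var 0) (Var 0)"
| dev_Abbr: "dev K V D \<Longrightarrow> dev ((Abbr, V) # K) (Var 0) (lift 0 D)"
| dev_weak: "dev K (Var i) D \<Longrightarrow> dev (E # K) (Var (Suc i)) (lift 0 D)"
| dev_App: "dev L V D \<Longrightarrow> dev L T F \<Longrightarrow> (\<And>b W B. T \<noteq> Bind b W B) \<Longrightarrow> dev L (App V T) (App D F)"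
| dev_App_Lam: "dev L V D \<Longrightarrow> dev L W F \<Longrightarrow> dev ((Abst, W) # L) B G \<Longrightarrow>
    dev L (App V (Lam W B)) (Def (Cast F D) G)"
| dev_App_Def: "dev L V D \<Longrightarrow> dev ((Abbr, W) # L) B (lift 0 F) \<Longrightarrow>
    dev L (App V (Def W B)) (App D F)"
| dev_Lam: "dev L W D \<Longrightarrow> dev ((Abst, W) # L) T F \<Longrightarrow> dev L (Lam W T) (Lam D F)"
| dev_Def: "dev ((Abbr, V) # L) T (lift 0 F) \<Longrightarrow> dev L (Def V T) F"
| dev_Cast: "\<not> conv L U (ty L T) \<Longrightarrow> dev L U D \<Longrightarrow> dev L T F \<Longrightarrow> dev L (Cast U T) (Cast D F)"
| dev_eps: "conv L U (ty L T) \<Longrightarrow> dev L T F \<Longrightarrow> dev L (Cast U T) F"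

inductive_cases dev_LamE: "dev L (Lam W T) D"
inductive_cases dev_DefE: "dev L (Def W T) D"

lemma dev_not_occurs:
  "dev L T D \<Longrightarrow> k < length L \<Longrightarrow> fst (L ! k) = Abbr \<Longrightarrow> \<not> occurs k D"
proof (induction arbitrary: k rule: dev.induct)
  case (dev_Abbr K V D)
  then show ?case by (cases k) (auto simp: occurs_lift)
next
  case (dev_weak K i D E)
  then show ?case by (cases k) (auto simp: occurs_lift)
next
  case (dev_App_Def L V D W B F)
  then show ?case using dev_App_Def.IH(2)[of "Suc k"] by (auto simp: occurs_lift)
next
  case (dev_Def V L T F)
  then show ?case using dev_Def.IH[of "Suc k"] by (auto simp: occurs_lift)
qed (auto simp: nth_Cons' split: if_splits)

text \<open>Developing a defined variable means developing its definiens, which is not a subterm.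
  Hence \<open>ex\<close> is an induction on terms that assumes developments of the entries, and an
  induction on the environment then discharges this assumption.\<close>

lemma dev_total: "\<exists>D. dev L T D"
proof -
  have ex: "\<exists>D. dev L T D" if "\<And>M b V K. L = M @ (b, V) # K \<Longrightarrow> \<exists>D. dev K V D" for L T
    using that
  proof (induction T arbitrary: L)
    case (Var i)
    then show ?case
    proof (induction L arbitrary: i)
      case (Cons E L)
      obtain b V where E: "E = (b, V)" by fastforce
      show ?case
      proof (cases i)
        case 0
        from Cons.prems[of "[]" b V L] E obtain D where "dev L V D" by auto
        with 0 E show ?thesis by (cases b) (auto intro: dev_Abst dev_Abbr)
      next
        case (Suc j)
        have "\<exists>D. dev L (Var j) D"
        proof (rule Cons.IH)
          fix M b V K
          assume "L = M @ (b, V) # K"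
          then show "\<exists>D. dev K V D"
            by (intro Cons.prems[of "E # M" b]) simp
        qed
        with Suc show ?thesis by (auto intro: dev_weak)
      qed
    qed (auto intro: dev_Nil)
  next
    case (App V T)
    then obtain D F where "dev L V D" "dev L T F" by blast
    then show ?case
    proof (cases "\<exists>b W B. T = Bind b W B")
      case True
      then obtain b W B where "T = Bind b W B" by blast
      with \<open>dev L V D\<close> \<open>dev L T F\<close> show ?thesis
        by (cases b) (auto elim!: dev_LamE dev_DefE intro: dev_App_Lam dev_App_Def)
    qed (blast intro: dev_App)
  next
    case (Bind b V T)
    obtain D where D: "dev L V D" using Bind by blast
    have "\<exists>F. dev ((b, V) # L) T F"
    proof (rule Bind.IH(2))
      fix M b' V' K
      assume "(b, V) # L = M @ (b', V') # K"
      with Bind.prems D show "\<exists>D. dev K V' D"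
        by (cases M) auto
    qed
    then obtain F where F: "dev ((b, V) # L) T F" by blast
    show ?case
    proof (cases b)
      case Abst
      with D F show ?thesis by (auto intro: dev_Lam)
    next
      case Abbr
      \<comment> \<open>The development has no occurrence of the defined variable, so it has the
        lifted form that \<open>dev_Def\<close> requires.\<close>
      with dev_not_occurs[OF F, of 0] have "F = lift 0 (subst 0 V F)"
        by (simp add: lift_subst_not_occurs)
      with F Abbr show ?thesis by (metis dev_Def)
    qed
  next
    case (Cast U T)
    then show ?case by (meson dev_Cast dev_eps)
  qed (auto intro: dev_Sort)
  have "\<exists>D. dev K V D" if "L = M @ (b, V) # K" for M b V K
    using that
  proof (induction L arbitrary: M b V K)
    case (Cons E L)
    show ?case
    proof (cases M)
      case Nil
      with Cons.prems have "K = L" by simp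
      have "\<exists>D. dev L V D"
        by (rule ex) (rule Cons.IH)
      with \<open>K = L\<close> show ?thesis by simp
    next
      case (Cons E' M')
      with Cons.prems show ?thesis by (auto intro: Cons.IH)
    qed
  qed simp
  then show ?thesis by (rule ex)
qed

text \<open>This is Takahashi's triangle property. The environment is reduced as well, because a
  reduced binder places its body under the reduced bound term.\<close>

lemma dev_triangle: "dev L T D \<Longrightarrow> par L T T' \<Longrightarrow> par_env L L' \<Longrightarrow> par L' T' D"
proof (induction arbitrary: T' L' rule: dev.induct)
  case (dev_Sort L s)
  then show ?case by (auto elim: par_SortE)
next
  case (dev_Nil i)
  from dev_Nil.prems(1) show ?case by (cases rule: par_Var_NilE) auto
next
  case (dev_Abst W K)
  from dev_Abst.prems(1) show ?case by (cases rule: par_Var_0E) auto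
next
  case (dev_Abbr K V D)
  from dev_Abbr.prems(2) obtain V' K' where L': "L' = (Abbr, V') # K'" "par K V V'" "par_env K K'"
    by cases auto
  from dev_Abbr.prems(1) show ?case
    by (cases rule: par_Var_0E) (use L' dev_Abbr.IH in \<open>auto intro: par_delta par_lift_0\<close>)
next
  case (dev_weak K i D E)
  from dev_weak.prems(2) obtain E' K' where L': "L' = E' # K'" "par_env K K'"
    by cases auto
  from dev_weak.prems(1) show ?case
    by (cases rule: par_Var_SucE) (use L' dev_weak.IH in \<open>auto intro: par_weak par_lift_0\<close>)
next
  case (dev_App L V D T F)
  from dev_App.prems(1) show ?case
    by (cases rule: par_AppE) (use dev_App in \<open>auto intro: par_App\<close>)
next
  case (dev_App_Lam L V D W F B G)
  have body: "par ((Abst, W') # L') B' G" if "par L W W'" "par ((Abst, W) # L) B B'" for W' B'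
    using dev_App_Lam.IH(3) that dev_App_Lam.prems(2) par_env_Cons by blast
  from dev_App_Lam.prems(1) show ?case
  proof cases
    case (par_App V' X)
    then obtain W' B' where "X = Lam W' B'" "par L W W'" "par ((Abst, W) # L) B B'"
      by (auto elim: par_LamE)
    with par_App body dev_App_Lam show ?thesis by (auto intro!: par_beta)
  next
    case (par_beta V' W' B')
    then have "par ((Abst, W') # L') B' G"
      by (intro body)
    \<comment> \<open>The contracted redex puts the body under a definition, whereas the induction
      hypothesis treats it under the abstraction.\<close>
    then have "par ((Abbr, Cast W' V') # L') B' G"
      by (rule par_refine[where M = "[]", simplified]) simp
    with par_beta dev_App_Lam show ?thesis by (auto intro!: par_Bind par_Cast)
  qed
next
  case (dev_App_Def L V D W B F)
  have body: "par ((Abbr, W') # L') B' (lift 0 F)" if "par L W W'" "par ((Abbr, W) # L) B B'" for W' B'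
    using dev_App_Def.IH(2) that dev_App_Def.prems(2) par_env_Cons by blast
  from dev_App_Def.prems(1) show ?case
  proof cases
    case (par_App V' X)
    from \<open>par L (Def W B) X\<close> have "par L' X F"
    proof cases
      case (par_Bind W' B')
      with body show ?thesis by (auto intro: par_zeta)
    next
      case par_zeta
      \<comment> \<open>Both sides of \<open>body\<close> are lifted here, so substituting for index
        0 cancels the lifts and leaves the definition's environment.\<close>
      from par_subst[OF body[OF par_refl par_zeta] subst_0] show ?thesis by simp
    qed
    with par_App dev_App_Def show ?thesis by (auto intro!: par_conv.par_App)
  next
    case (par_theta V' W' B')
    \<comment> \<open>The development has dropped the definition; hence the target is its lifting,
      and \<open>par_zeta\<close> removes the binder that the \<theta>-step moved outwards.\<close>
    have "par ((Abbr, W') # L') (App (lift 0 V') B') (lift 0 (App D F))"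
      using par_theta body dev_App_Def by (auto intro!: par_App par_lift_0)
    with par_theta show ?thesis by (auto intro: par_zeta)
  qed
next
  case (dev_Lam L W D T F)
  from dev_Lam.prems(1) show ?case
    by (cases rule: par_LamE) (use dev_Lam in \<open>auto intro!: par_Bind dev_Lam.IH intro: par_env_Cons\<close>)
next
  case (dev_Def V L T F)
  have body: "par ((Abbr, V') # L') B' (lift 0 F)" if "par L V V'" "par ((Abbr, V) # L) T B'" for V' B'
    using dev_Def.IH that dev_Def.prems(2) par_env_Cons by blast
  from dev_Def.prems(1) show ?case
  proof cases
    case (par_Bind V' B')
    with body show ?thesis by (auto intro: par_zeta)
  next
    case par_zeta
    from par_subst[OF body[OF par_refl par_zeta] subst_0] show ?thesis by simp
  qed
next
  case (dev_Cast L U T D F)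
  from dev_Cast.prems(1) show ?case
  proof cases
    case (par_Cast U' T')
    with dev_Cast show ?thesis by (auto intro: par_conv.par_Cast)
  next
    case par_eps
    with dev_Cast.hyps show ?thesis by simp
  qed
next
  case (dev_eps L U T F)
  from dev_eps.prems(1) show ?case
  proof cases
    case (par_Cast U' T')
    with dev_eps show ?thesis by (auto intro: par_conv.par_eps conv_Cast_par)
  next
    case par_eps
    with dev_eps show ?thesis by simp
  qed
qed

lemma par_confluent: "par L T T1 \<Longrightarrow> par L T T2 \<Longrightarrow> \<exists>T'. par L T1 T' \<and> par L T2 T'"
  using dev_total dev_triangle par_env_refl by metis

abbreviation pars :: "'s env \<Rightarrow> 's trm \<Rightarrow> 's trm \<Rightarrow> bool" where
  "pars L \<equiv> (par L)\<^sup>*\<^sup>*"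

lemma pars_confluent:
  assumes "pars L T T1" "pars L T T2"
  shows "\<exists>T'. pars L T1 T' \<and> pars L T2 T'"
proof -
  have strip: "\<exists>T'. pars L T1 T' \<and> par L T2 T'" if "par L T T1" "pars L T T2" for T T1 T2
    using that(2,1)
  proof (induction)
    case (step X Y)
    then obtain Z where "pars L T1 Z" "par L X Z" by blast
    with par_confluent[OF \<open>par L X Y\<close>] show ?case
      by (meson rtranclp.rtrancl_into_rtrancl)
  qed blast
  show ?thesis
    using assms
  proof (induction)
    case (step X Y)
    then obtain Z where "pars L X Z" "pars L T2 Z" by blast
    with strip[OF \<open>par L X Y\<close>] show ?case
      by (meson r_into_rtranclp rtranclp_trans)
  qed blast
qed

lemma church_rosser: "conv L T1 T2 \<Longrightarrow> \<exists>T'. pars L T1 T' \<and> pars L T2 T'"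
proof (induction L T1 T2 rule: par_conv.inducts(2)[where ?P1.0 = "\<lambda>_ _ _. True"])
  case (conv_trans L T T' T'')
  then obtain X Y where "pars L T X" "pars L T' X" "pars L T' Y" "pars L T'' Y" by blast
  with pars_confluent[of L T' X Y] show ?case
    by (meson rtranclp_trans)
qed blast+

lemma pars_Lam: "pars L (Lam W T) X \<Longrightarrow> \<exists>W' T'. X = Lam W' T' \<and> conv L W W'"
  by (induction rule: rtranclp_induct) (auto elim!: par_LamE dest: conv_par intro: conv_trans)

text \<open>A common reduct of two abstractions is again an abstraction, and its domain is
  convertible with both domains.\<close>

lemma conv_Lam_inject:
  assumes "conv L (Lam W T) (Lam W' T')"
  shows "conv L W W'"
proof -
  from church_rosser[OF assms] obtain X where "pars L (Lam W T) X" "pars L (Lam W' T') X" by blast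
  then show ?thesis by (auto dest!: pars_Lam intro: conv_sym conv_trans)
qed

section \<open>Validity up to conversion\<close>

inductive cvalid :: "nat set \<Rightarrow> 's env \<Rightarrow> 's trm \<Rightarrow> bool" for A where
  cvalid_Sort: "cvalid A L (Sort s)"
| cvalid_Var_0: "cvalid A K V \<Longrightarrow> cvalid A ((b, V) # K) (Var 0)"
| cvalid_Var_Suc: "cvalid A K (Var i) \<Longrightarrow> cvalid A (E # K) (Var (Suc i))"
| cvalid_Bind: "cvalid A L V \<Longrightarrow> cvalid A ((b, V) # L) T \<Longrightarrow> cvalid A L (Bind b V T)"
| cvalid_Cast: "cvalid A L U \<Longrightarrow> cvalid A L T \<Longrightarrow> conv L U (ty L T) \<Longrightarrow> cvalid A L (Cast U T)"
| cvalid_App: "cvalid A L V \<Longrightarrow> cvalid A L T \<Longrightarrow> n \<in> A \<Longrightarrow>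
    conv L ((ty L ^^ n) T) (Lam W0 U0) \<Longrightarrow> conv L (ty L V) W0 \<Longrightarrow> cvalid A L (App V T)"

inductive_cases cvalid_Var_0E: "cvalid A (E # K) (Var 0)"
inductive_cases cvalid_Var_SucE: "cvalid A (E # K) (Var (Suc i))"
inductive_cases cvalid_BindE: "cvalid A L (Bind b V T)"
inductive_cases cvalid_CastE: "cvalid A L (Cast U T)"
inductive_cases cvalid_AppE: "cvalid A L (App V T)"

lemma cvalid_lift: "cvalid A L T \<Longrightarrow> insert_env k L L' \<Longrightarrow> cvalid A L' (lift k T)"
proof (induction arbitrary: k L' rule: cvalid.induct)
  case (cvalid_Var_0 K V b)
  from cvalid_Var_0.prems show ?case
    by cases (auto intro: cvalid.intros cvalid_Var_0)
next
  case (cvalid_Var_Suc K i E)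
  from cvalid_Var_Suc.prems show ?case
  proof cases
    case (insert_Suc k K' b W)
    with cvalid_Var_Suc.IH have "cvalid A K' (Var (if i < k then i else Suc i))" by simp
    from cvalid.cvalid_Var_Suc[OF this] insert_Suc show ?thesis
      by (cases "i < k") simp_all
  qed (auto intro: cvalid.intros cvalid_Var_Suc)
next
  case (cvalid_Bind L V b T)
  then show ?case by (auto intro!: cvalid.cvalid_Bind cvalid_Bind.IH insert_Suc)
next
  case (cvalid_Cast L U T)
  then have "conv L' (lift k U) (ty L' (lift k T))"
    by (simp add: ty_lift conv_lift)
  with cvalid_Cast show ?case by (auto intro: cvalid.cvalid_Cast)
next
  case (cvalid_App L V T n W0 U0)
  have "conv L' ((ty L' ^^ n) (lift k T)) (Lam (lift k W0) (lift (Suc k) U0))"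
    using conv_lift[OF cvalid_App.hyps(4) cvalid_App.prems] cvalid_App.prems
    by (simp add: funpow_ty_lift)
  moreover have "conv L' (ty L' (lift k V)) (lift k W0)"
    using conv_lift[OF cvalid_App.hyps(5) cvalid_App.prems] cvalid_App.prems
    by (simp add: ty_lift)
  ultimately show ?case
    using cvalid_App by (auto intro: cvalid.cvalid_App)
qed (auto intro: cvalid.intros)

lemmas cvalid_lift_0 = cvalid_lift [OF _ insert_0]

text \<open>Where the variable is replaced, validity of \<open>V\<close> is the premise of
  \<open>cvalid_Var_0\<close>.\<close>

lemma cvalid_subst:
  "cvalid A L T \<Longrightarrow> subst_env k V L L' \<Longrightarrow> cvalid A L' (subst k V T)"
proof (induction arbitrary: k V L' rule: cvalid.induct)
  case (cvalid_Var_0 K W b)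
  from cvalid_Var_0.prems show ?case
    by cases (use cvalid_Var_0 in \<open>auto intro: cvalid.cvalid_Var_0\<close>)
next
  case (cvalid_Var_Suc K i E)
  from cvalid_Var_Suc.prems show ?case
  proof cases
    case (subst_Suc k V K' b W)
    with cvalid_Var_Suc.IH have "cvalid A K' (subst k V (Var i))" by simp
    from cvalid_lift_0[OF this] show ?thesis
      unfolding subst_Suc subst_Suc_lift [symmetric] by simp
  qed (use cvalid_Var_Suc.hyps in auto)
next
  case (cvalid_Bind L U b T)
  then show ?case by (auto intro!: cvalid.cvalid_Bind cvalid_Bind.IH subst_Suc)
next
  case (cvalid_Cast L U T)
  then have "conv L' (subst k V U) (ty L' (subst k V T))"
    by (simp add: ty_subst conv_subst)
  with cvalid_Cast show ?case by (auto intro: cvalid.cvalid_Cast)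
next
  case (cvalid_App L U T n W0 U0)
  have "conv L' ((ty L' ^^ n) (subst k V T)) (Lam (subst k V W0) (subst (Suc k) (lift 0 V) U0))"
    using conv_subst[OF cvalid_App.hyps(4) cvalid_App.prems] cvalid_App.prems
    by (simp add: funpow_ty_subst)
  moreover have "conv L' (ty L' (subst k V U)) (subst k V W0)"
    using conv_subst[OF cvalid_App.hyps(5) cvalid_App.prems] cvalid_App.prems
    by (simp add: ty_subst)
  ultimately show ?case
    using cvalid_App by (auto intro: cvalid.cvalid_App)
qed (auto intro: cvalid.intros)

text \<open>This covers both changes of an entry in \<open>cvalid_step\<close>: a \<beta>-step makes
  an abstraction entry a definition by a cast, and \<open>bind_arg\<close> reduces the bound
  term.\<close>

lemma cvalid_env:
  "cvalid A L T \<Longrightarrow> L = M @ E # K \<Longrightarrow> env_conv (E # K) ((b', V') # K) \<Longrightarrow> cvalid A K V' \<Longrightarrow>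
    cvalid A (M @ (b', V') # K) T"
proof (induction arbitrary: M rule: cvalid.induct)
  case (cvalid_Var_0 K V b)
  then show ?case by (cases M) (auto intro: cvalid.cvalid_Var_0)
next
  case (cvalid_Var_Suc K i E)
  then show ?case by (cases M) (auto intro: cvalid.cvalid_Var_Suc)
next
  case (cvalid_Bind L V b T)
  then show ?case using cvalid_Bind.IH(2)[of "(b, V) # M"] by (auto intro: cvalid.cvalid_Bind)
next
  case (cvalid_Cast L U T)
  let ?L = "M @ (b', V') # K"
  have "env_conv L ?L"
    using cvalid_Cast.prems by (auto intro: env_conv_append)
  then have "conv ?L U (ty ?L T)"
    using cvalid_Cast.hyps conv_env conv_ty_env conv_trans by blast
  with cvalid_Cast show ?case by (auto intro: cvalid.cvalid_Cast)
next
  case (cvalid_App L V T n W0 U0)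
  let ?L = "M @ (b', V') # K"
  have "env_conv L ?L"
    using cvalid_App.prems by (auto intro: env_conv_append)
  then have "conv ?L ((ty ?L ^^ n) T) (Lam W0 U0)" "conv ?L (ty ?L V) W0"
    using cvalid_App.hyps conv_env conv_ty_env conv_funpow_ty_env conv_trans conv_sym by meson+
  with cvalid_App show ?case by (auto intro: cvalid.cvalid_App)
qed (auto intro: cvalid.intros)

text \<open>The two conclusions depend on each other: validity makes the erasure of casts a
  conversion, and the conversion carries the premises of validity over to the reduct.\<close>

lemma cvalid_step:
  "step nxt L n T T' \<Longrightarrow> cvalid A L T \<Longrightarrow> cvalid A L T' \<and> conv L T' ((ty L ^^ n) T)"
proof (induction rule: step.induct)
  case (beta L V W T)
  then obtain n W0 U0 where n: "n \<in> A" "conv L ((ty L ^^ n) (Lam W T)) (Lam W0 U0)"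
      "conv L (ty L V) W0"
    and valid: "cvalid A L V" "cvalid A L W" "cvalid A ((Abst, W) # L) T"
    by (auto elim!: cvalid_AppE cvalid_BindE)
  \<comment> \<open>Iterated types of \<open>Lam W T\<close> are abstractions over the same
    \<open>W\<close>, so injectivity identifies \<open>W\<close> with \<open>W0\<close>. This makes
    the new cast good.\<close>
  have "conv L W W0"
    using n(2) by (auto simp: funpow_ty_Bind dest: conv_Lam_inject)
  with n(3) valid have cast: "cvalid A L (Cast W V)"
    by (auto intro: cvalid_Cast conv_sym conv_trans)
  have "cvalid A ((Abbr, Cast W V) # L) T"
    using cvalid_env[OF valid(3), of "[]" "(Abst, W)" L Abbr "Cast W V"] cast
    by (auto intro: env_conv_refine env_conv_refl)
  moreover have "conv L (Def (Cast W V) T) (App V (Lam W T))"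
    by (auto intro: conv_sym conv_par par_beta)
  ultimately show ?case
    using cast by (auto intro: cvalid_Bind)
next
  case (delta V K)
  then show ?case
    by (auto elim!: cvalid_Var_0E intro: cvalid_lift_0 conv_sym conv_par par_delta)
next
  case (zeta L V T)
  then have "cvalid A L T"
    using cvalid_subst[OF _ subst_0, of A V L "lift 0 T"] by (auto elim: cvalid_BindE)
  then show ?case
    by (auto intro: conv_sym conv_par par_zeta)
next
  case (theta L V W T)
  let ?L = "(Abbr, W) # L"
  from theta obtain n W0 U0 where n: "n \<in> A" "conv L (Def W ((ty ?L ^^ n) T)) (Lam W0 U0)"
      "conv L (ty L V) W0"
    and valid: "cvalid A L V" "cvalid A L W" "cvalid A ?L T"
    by (auto elim!: cvalid_AppE cvalid_BindE simp: funpow_ty_Bind)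
  let ?X = "(ty ?L ^^ n) T"
  \<comment> \<open>The premise concerns \<open>Def W ?X\<close>, but the application under the
    definition needs an abstraction convertible with \<open>?X\<close> itself. Unfolding
    \<open>W\<close> throughout \<open>?X\<close> lets \<open>par_zeta\<close> drop the definition,
    and lifting returns to \<open>?L\<close>.\<close>
  have unfold: "par ?L ?X (lift 0 (subst 0 W ?X))"
    by (rule par_subst_lift) (rule subst_0)
  then have "conv L (subst 0 W ?X) (Lam W0 U0)"
    using n(2) by (meson conv_par conv_sym conv_trans par_zeta)
  then have "conv ?L (lift 0 (subst 0 W ?X)) (lift 0 (Lam W0 U0))"
    by (rule conv_lift_0)
  with unfold have "conv ?L ?X (Lam (lift 0 W0) (lift (Suc 0) U0))"
    by (auto intro: conv_trans conv_par)
  moreover have "conv ?L (ty ?L (lift 0 V)) (lift 0 W0)"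
    unfolding ty_lift_0 using n(3) by (rule conv_lift_0)
  ultimately have "cvalid A ?L (App (lift 0 V) T)"
    using n(1) valid by (auto intro: cvalid_App cvalid_lift_0)
  with valid show ?case
    by (auto intro: cvalid_Bind conv_sym conv_par par_theta)
next
  case (eps L U T)
  then show ?case
    by (auto elim!: cvalid_CastE intro: conv_sym conv_par par_eps)
next
  case (sort L s)
  then show ?case by (auto intro: cvalid_Sort)
next
  case (ell W K)
  then show ?case
    by (auto elim!: cvalid_Var_0E intro: cvalid_lift_0)
next
  case (ee L U T)
  then show ?case by (auto elim: cvalid_CastE)
next
  case (weak K n i T b V)
  then have IH: "cvalid A K T" "conv K T ((ty K ^^ n) (Var i))"
    by (auto elim: cvalid_Var_SucE)
  have "conv ((b, V) # K) (lift 0 T) ((ty ((b, V) # K) ^^ n) (lift 0 (Var i)))"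
    unfolding funpow_ty_lift[OF insert_0] using IH(2) by (rule conv_lift_0)
  with IH(1) show ?case by (simp add: cvalid_lift_0)
next
  case (app_arg L V1 V2 T)
  then obtain n W0 U0 where n: "n \<in> A" "conv L ((ty L ^^ n) T) (Lam W0 U0)"
      "conv L (ty L V1) W0" "cvalid A L T" and V: "cvalid A L V2" "conv L V2 V1"
    by (auto elim!: cvalid_AppE)
  have "conv L (ty L V2) W0"
    using conv_ty[OF V(2)] n(3) by (rule conv_trans)
  with n V show ?case by (auto intro: cvalid_App conv_App)
next
  case (app_fun L m T1 T2 V)
  then obtain n W0 U0 where n: "n \<in> A" "conv L ((ty L ^^ n) T1) (Lam W0 U0)"
      "conv L (ty L V) W0" "cvalid A L V" and T: "cvalid A L T2" "conv L T2 ((ty L ^^ m) T1)"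
    by (auto elim!: cvalid_AppE)
  \<comment> \<open>Iterations of \<open>ty\<close> commute, and the \<open>m\<close>-fold type of
    an abstraction is an abstraction over the same domain. Thus the same \<open>n\<close> in
    \<open>A\<close> serves for \<open>T2\<close>.\<close>
  have "conv L ((ty L ^^ n) T2) ((ty L ^^ n) ((ty L ^^ m) T1))"
    using T(2) by (rule conv_funpow_ty)
  also have "(ty L ^^ n) ((ty L ^^ m) T1) = (ty L ^^ m) ((ty L ^^ n) T1)"
    by (metis add.commute comp_apply funpow_add)
  also have "conv L \<dots> ((ty L ^^ m) (Lam W0 U0))"
    using n(2) by (rule conv_funpow_ty)
  finally have "conv L ((ty L ^^ n) T2) (Lam W0 ((ty ((Abst, W0) # L) ^^ m) U0))"
    by (simp add: funpow_ty_Bind)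
  with n T show ?case
    by (auto intro: cvalid_App conv_App simp: funpow_ty_App)
next
  case (bind_arg L V1 V2 b T)
  then have V: "cvalid A L V2" "conv L V2 V1" and T: "cvalid A ((b, V1) # L) T"
    by (auto elim!: cvalid_BindE)
  have "env_conv ((b, V1) # L) ((b, V2) # L)"
    using V(2) by (auto intro: env_conv_Cons env_conv_refl conv_ty conv_sym)
  then have "cvalid A ((b, V2) # L) T"
    using cvalid_env[OF T, of "[]"] V(1) by simp
  with V show ?case by (auto intro: cvalid_Bind conv_Bind_arg)
next
  case (bind_body b V L n T1 T2)
  then show ?case
    by (auto elim!: cvalid_BindE intro: cvalid_Bind conv_Bind_body simp: funpow_ty_Bind)
next
  case (cast_type L U1 U2 T)
  then show ?case
    by (auto elim!: cvalid_CastE intro: cvalid_Cast conv_trans conv_Cast_type)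
next
  case (cast_term L T1 T2 U)
  then show ?case
    by (auto elim!: cvalid_CastE intro: cvalid_Cast conv_trans conv_Cast_term conv_ty conv_sym)
next
  case (cast_both L U1 U2 T1 T2)
  then have U: "cvalid A L U2" "conv L U2 (ty L U1)" and T: "cvalid A L T2" "conv L T2 (ty L T1)"
    and UT: "conv L U1 (ty L T1)"
    by (auto elim!: cvalid_CastE)
  \<comment> \<open>The type of the original cast is \<open>U1\<close>. As \<open>T2\<close>
    converts to it, the new cast is good, and erasing it yields the required conversion.\<close>
  have "conv L T2 U1"
    using T(2) UT by (blast intro: conv_sym conv_trans)
  then have "conv L U2 (ty L T2)"
    using U(2) by (blast intro: conv_ty conv_sym conv_trans)
  moreover from this have "conv L (Cast U2 T2) T2"
    by (auto intro: conv_par par_eps)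
  ultimately show ?case
    using U T \<open>conv L T2 U1\<close> by (auto intro: cvalid_Cast conv_trans)
qed

lemma cvalid_steps:
  "steps nxt L n T T' \<Longrightarrow> cvalid A L T \<Longrightarrow> cvalid A L T' \<and> conv L T' ((ty L ^^ n) T)"
proof (induction rule: steps.induct)
  case (single n T1 T2)
  then show ?case by (rule cvalid_step)
next
  case (trans n1 T1 T n2 T2)
  then have "conv L T2 ((ty L ^^ n2) T)" "conv L T ((ty L ^^ n1) T1)" "cvalid A L T2"
    by blast+
  then have "conv L T2 ((ty L ^^ n2) ((ty L ^^ n1) T1))"
    by (blast intro: conv_trans conv_funpow_ty)
  with \<open>cvalid A L T2\<close> show ?case
    by (metis add.commute comp_apply funpow_add)
qed simp

text \<open>By \<open>cvalid_steps\<close>, a reduction with bound \<open>n\<close> in a premise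
  ends in the \<open>n\<close>-fold canonical type up to conversion.\<close>

lemma valid_imp_cvalid: "valid nxt A L T \<Longrightarrow> cvalid A L T"
proof (induction rule: valid.induct)
  case (cast L U T U0)
  then have "conv L U0 (ty L T)" "conv L U0 U"
    using cvalid_steps by fastforce+
  with cast show ?case by (blast intro: cvalid_Cast conv_sym conv_trans)
next
  case (app L V T n W0 U0)
  then have "conv L (Lam W0 U0) ((ty L ^^ n) T)" "conv L W0 (ty L V)"
    using cvalid_steps by fastforce+
  with app show ?case by (blast intro: cvalid_App conv_sym)
qed (auto intro: cvalid.intros)

section \<open>From conversions back to reductions\<close>

lemma step_lift: "step nxt L n T T' \<Longrightarrow> insert_env k L L' \<Longrightarrow> step nxt L' n (lift k T) (lift k T')"
proof (induction arbitrary: k L' rule: step.induct)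
  case (delta V K)
  from delta.prems show ?case
  proof cases
    case (insert_0 E)
    with step.weak[OF step.delta] show ?thesis by (cases E) simp
  next
    case (insert_Suc k K')
    with step.delta show ?thesis by (simp add: lift_lift_0 [symmetric])
  qed
next
  case (ell W K)
  from ell.prems show ?case
  proof cases
    case (insert_0 E)
    with step.weak[OF step.ell] show ?thesis by (cases E) simp
  next
    case (insert_Suc k K')
    with step.ell show ?thesis by (simp add: lift_lift_0 [symmetric])
  qed
next
  case (weak K n i T b V)
  from weak.prems show ?case
  proof cases
    case (insert_0 E)
    with step.weak[OF step.weak[OF weak.hyps]] show ?thesis by (cases E) simp
  next
    case (insert_Suc k K')
    with weak.IH have "step nxt K' n (Var (if i < k then i else Suc i)) (lift k T)"
      by simp
    from step.weak[OF this] insert_Suc show ?thesis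
      by (cases "i < k") (simp_all add: lift_lift_0 [symmetric])
  qed
next
  case (zeta L V T)
  then show ?case by (simp add: lift_lift_0 [symmetric] step.zeta)
next
  case (theta L V W T)
  then show ?case by (simp add: lift_lift_0 [symmetric] step.theta)
next
  case (bind_body b V L n T1 T2)
  then show ?case by (auto intro!: step.bind_body bind_body.IH insert_Suc)
qed (auto intro: step.intros simp del: One_nat_def)

lemma steps_lift_0: "steps nxt L n T T' \<Longrightarrow> steps nxt (E # L) n (lift 0 T) (lift 0 T')"
  by (induction rule: steps.induct) (auto intro: steps.intros step_lift insert_0)

lemma steps_trans_0: "steps nxt L 0 T1 T \<Longrightarrow> steps nxt L n T T2 \<Longrightarrow> steps nxt L n T1 T2"
  using steps.trans by fastforce

lemma steps_trans_0_right: "steps nxt L n T1 T \<Longrightarrow> steps nxt L 0 T T2 \<Longrightarrow> steps nxt L n T1 T2"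
  using steps.trans by fastforce

lemma steps_cong:
  assumes "steps nxt L n T T'" and "\<And>m X Y. step nxt L m X Y \<Longrightarrow> step nxt L' m (f X) (f Y)"
  shows "steps nxt L' n (f T) (f T')"
  using assms(1) by (induction rule: steps.induct) (auto intro: steps.intros assms(2))

text \<open>For positions that admit only r-steps. The bound is a variable equated with 0, so that
  in the transitive case both summands are seen to vanish.\<close>

lemma steps_0_cong:
  assumes "steps nxt L n T T'" "n = 0" and "\<And>X Y. step nxt L 0 X Y \<Longrightarrow> step nxt L' 0 (f X) (f Y)"
  shows "steps nxt L' 0 (f T) (f T')"
  using assms(1,2) by (induction rule: steps.induct) (auto intro: steps.intros steps_trans_0 assms(3))

lemma steps_App:
  assumes "steps nxt L 0 V V'" "steps nxt L n T T'"
  shows "steps nxt L n (App V T) (App V' T')"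
  using steps_0_cong[OF assms(1) HOL.refl, of L "\<lambda>V. App V T"] steps_cong[OF assms(2), of L "App V'"]
  by (blast intro: steps_trans_0 step.intros)

text \<open>The body is reduced first, while \<open>V\<close> is still the entry of its
  environment.\<close>

lemma steps_Bind:
  assumes "steps nxt L 0 V V'" "steps nxt ((b, V) # L) n T T'"
  shows "steps nxt L n (Bind b V T) (Bind b V' T')"
  using steps_0_cong[OF assms(1) HOL.refl, of L "\<lambda>V. Bind b V T'"] steps_cong[OF assms(2), of L "Bind b V"]
  by (blast intro: steps_trans_0_right step.intros)

lemma steps_Cast:
  assumes "steps nxt L 0 U U'" "steps nxt L 0 T T'"
  shows "steps nxt L 0 (Cast U T) (Cast U' T')"
  using steps_0_cong[OF assms(1) HOL.refl, of L "\<lambda>U. Cast U T"]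
    steps_0_cong[OF assms(2) HOL.refl, of L "Cast U'"]
  by (blast intro: steps_trans_0 step.intros)

lemma par_steps: "par L T T' \<Longrightarrow> steps nxt L 0 T T'"
proof (induction rule: par_conv.inducts(1)[where ?P2.0 = "\<lambda>_ _ _. True"])
  case (par_delta K V V')
  then show ?case by (blast intro: steps_trans_0 steps.single step.delta steps_lift_0)
next
  case (par_weak K i T E)
  then show ?case using steps_lift_0[of K 0 "Var i" T E] by simp
next
  case (par_zeta V L T T')
  then have "steps nxt L 0 (Def V T) (Def V (lift 0 T'))"
    by (intro steps_Bind steps.refl)
  then show ?case by (blast intro: steps_trans_0 steps.single step.zeta)
next
  case (par_eps L U T T')
  then show ?case by (blast intro: steps_trans_0 steps.single step.eps)
next
  case (par_beta L V V' W W' T T')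
  then have "steps nxt L 0 (App V (Lam W T)) (App V' (Lam W' T'))"
    by (intro steps_App steps_Bind)
  then show ?case by (blast intro: steps_trans_0 steps.single step.beta)
next
  case (par_theta L V V' W W' T T')
  then have "steps nxt L 0 (App V (Def W T)) (App V' (Def W' T'))"
    by (intro steps_App steps_Bind)
  then show ?case by (blast intro: steps_trans_0 steps.single step.theta)
qed (auto intro: steps.refl steps_App steps_Bind steps_Cast)

lemma pars_steps: "pars L T T' \<Longrightarrow> steps nxt L 0 T T'"
  by (induction rule: rtranclp_induct) (auto intro: steps.refl steps_trans_0 par_steps)

text \<open>A defined variable is first unfolded, and then its definiens reduces to its type.
  Validity excludes unbound variables, which do not reduce to their default type in a
  t-step.\<close>

lemma steps_ty: "cvalid A L T \<Longrightarrow> steps nxt L 1 T (ty L T)"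
proof (induction rule: cvalid.induct)
  case (cvalid_Sort L s)
  show ?case using steps.single[OF step.sort] by simp
next
  case (cvalid_Var_0 K V b)
  show ?case
  proof (cases b)
    case Abst
    then show ?thesis using steps.single[OF step.ell] by simp
  next
    case Abbr
    with steps_trans_0[OF steps.single[OF step.delta] steps_lift_0[OF cvalid_Var_0.IH]] show ?thesis
      by simp
  qed
next
  case (cvalid_Var_Suc K i E)
  show ?case
    using steps_lift_0[OF cvalid_Var_Suc.IH, of E] by (cases E) simp
next
  case (cvalid_Bind L V b T)
  then show ?case by (auto intro: steps_Bind steps.refl)
next
  case (cvalid_Cast L U T)
  show ?case using steps.single[OF step.ee] by simp
next
  case (cvalid_App L V T n W0 U0)
  then show ?case by (auto intro: steps_App steps.refl)
qed

lemma steps_funpow_ty: "cvalid A L T \<Longrightarrow> steps nxt L n T ((ty L ^^ n) T)"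
proof (induction n)
  case (Suc n)
  \<comment> \<open>The intermediate type is a reduct of \<open>T\<close>, hence valid up to
    conversion, so \<open>steps_ty\<close> applies to it.\<close>
  then have "steps nxt L 1 ((ty L ^^ n) T) (ty L ((ty L ^^ n) T))"
    using cvalid_steps steps_ty by blast
  with Suc steps.trans[of nxt L n T _ 1] show ?case by simp
qed (simp add: steps.refl)

text \<open>Confluence replaces every conversion in a premise by reductions to a common term, and
  \<open>steps_ty\<close> or \<open>steps_funpow_ty\<close> supplies the t-steps that precede
  them.\<close>

lemma cvalid_imp_valid: "cvalid A L T \<Longrightarrow> valid nxt A L T"
proof (induction rule: cvalid.induct)
  case (cvalid_Var_Suc K i E)
  then show ?case by (cases E) (auto intro: valid.intros)
next
  case (cvalid_Cast L U T)
  from church_rosser[OF cvalid_Cast.hyps(3)]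
  obtain X where "steps nxt L 0 U X" "steps nxt L 0 (ty L T) X"
    using pars_steps by blast
  with cvalid_Cast show ?case
    by (blast intro: valid.cast steps_trans_0_right steps_ty)
next
  case (cvalid_App L V T n W0 U0)
  from church_rosser[OF cvalid_App.hyps(4)]
  obtain X where X: "pars L ((ty L ^^ n) T) X" "pars L (Lam W0 U0) X" by blast
  then obtain W1 U1 where W1: "X = Lam W1 U1" "conv L W0 W1"
    using pars_Lam by blast
  with cvalid_App.hyps(5) have "conv L (ty L V) W1"
    by (blast intro: conv_trans)
  \<comment> \<open>The rule \<open>valid.app\<close> demands one and the same domain on both sides.
    The domain \<open>W1\<close> is therefore reduced further, to a term that the type of
    \<open>V\<close> also reaches.\<close>
  from church_rosser[OF this] obtain Z where Z: "pars L (ty L V) Z" "pars L W1 Z" by blast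
  have "steps nxt L n T (Lam W1 U1)"
    using X(1) W1(1) cvalid_App.hyps(2)
    by (blast intro: steps_trans_0_right steps_funpow_ty pars_steps)
  then have "steps nxt L n T (Lam Z U1)"
    using Z(2) by (blast intro: steps_trans_0_right steps_Bind steps.refl pars_steps)
  moreover have "steps nxt L 1 V Z"
    using Z(1) cvalid_App.hyps(1) by (blast intro: steps_trans_0_right steps_ty pars_steps)
  ultimately show ?case
    using cvalid_App by (blast intro: valid.app)
qed (auto intro: valid.intros)

end

theorem theorem5p4:
  fixes nxt :: "'s \<Rightarrow> 's"
    and A :: "nat set"
    and L :: "'s env"
    and T1 T2 U :: "'s trm"
  assumes "has_type nxt A L T1 U"
    and "steps nxt L 0 T1 T2"
  shows "has_type nxt A L T2 U"
proof -
  \<comment> \<open>The judgment is the validity of a cast, so the claim is preservation for the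
    reduction inside this cast.\<close>
  have "steps nxt L 0 (Cast U T1) (Cast U T2)"
    using steps_Cast[OF steps.refl assms(2)] .
  moreover have "cvalid nxt A L (Cast U T1)"
    using assms(1) by (auto simp: has_type_def intro: valid_imp_cvalid)
  ultimately have "cvalid nxt A L (Cast U T2)"
    using cvalid_steps by blast
  then show ?thesis
    by (simp add: has_type_def cvalid_imp_valid)
qed

end
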